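(* Every bounded interval order is CL-shellable.
   Context: All posets are finite. A poset is bounded if it has a minimum element $\hat 0$ and a maximum element $\hat 1$. A poset $P$ is an interval order if its elements $x$ can be assigned closed intervals $I_x$ of the real line so that $x<y$ in $P$ if and only if $I_x$ lies entirely to the left of $I_y$ (i.e. $\max I_x<\min I_y$); by a well-known characterization, this is equivalent to $P$ not containing, as an induced subposet, the $4$-element poset consisting of two disjoint $2$-element chains (with no relations between the two chains). A bounded interval order is an interval order that is bounded as a poset. CL-shellability (general, not necessarily pure version). Let $P$ be a bounded poset. For a maximal chain $m:\hat 0=x_0\to x_1\to\cdots\to x_t=\hat 1$ of $P$ (each $x_{i}$ covering $x_{i-1}$), its edges are the pairs $(x_{i-1},x_i)$. A chain-edge labeling of $P$ assigns to each pair ($m$, edge of $m$), with $m$ a maximal chain, an element of some poset $\Lambda$, in such a way that whenever two maximal chains coincide along their first $d$ edges (from the bottom), their labels coincide along these $d$ edges. For $x<y$ in $P$ and a maximal chain $r$ of $[\hat 0,x]$, the pair $([x,y],r)$ is called a rooted interval $[x,y]_r$; each maximal chain $c$ of $[x,y]$ then receives a well-defined label sequence, namely the labels of the edges of $c$ in any maximal chain of $P$ that begins with $r$ followed by $c$. A chain-edge labeling is a CL-labeling if in each rooted interval $[x,y]_r$ there is a unique maximal chain whose label sequence is strictly increasing in $\Lambda$ (from bottom to top), and the label sequence of this chain lexicographically precedes the label sequences of all other maximal chains of $[x,y]_r$. (A sequence $\mathbf a$ precedes $\mathbf b\neq \mathbf a$ lexicographically if $a_i<b_i$ in $\Lambda$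 at the first position $i$ where they differ, or if $\mathbf a$ is a proper initial segment of $\mathbf b$.) The bounded poset $P$ is CL-shellable if it admits a CL-labeling. *)

theory Defs
  imports Complex_Main "HOL-Library.Sublist"
begin

text \<open>A finite poset is a carrier set \<open>P\<close> together with its weak order \<open>r \<subseteq> P \<times> P\<close>; the strict
  order is \<open>r - Id\<close>.\<close>

definition finite_poset :: "'a set \<Rightarrow> 'a rel \<Rightarrow> bool" where
  "finite_poset P r \<longleftrightarrow> finite P \<and> partial_order_on P r"

definition is_least :: "'a set \<Rightarrow> 'a rel \<Rightarrow> 'a \<Rightarrow> bool" where
  "is_least P r b \<longleftrightarrow> b \<in> P \<and> (\<forall>x\<in>P. (b, x) \<in> r)"

definition is_greatest :: "'a set \<Rightarrow> 'a rel \<Rightarrow> 'a \<Rightarrow> bool" where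
  "is_greatest P r t \<longleftrightarrow> t \<in> P \<and> (\<forall>x\<in>P. (x, t) \<in> r)"

definition bounded_poset :: "'a set \<Rightarrow> 'a rel \<Rightarrow> bool" where
  "bounded_poset P r \<longleftrightarrow> finite_poset P r \<and> (\<exists>b. is_least P r b) \<and> (\<exists>t. is_greatest P r t)"

definition poset_bot :: "'a set \<Rightarrow> 'a rel \<Rightarrow> 'a" where
  "poset_bot P r = (THE b. is_least P r b)"

definition poset_top :: "'a set \<Rightarrow> 'a rel \<Rightarrow> 'a" where
  "poset_top P r = (THE t. is_greatest P r t)"

text \<open>The interval assigned to \<open>x\<close> is the nonempty closed interval \<open>{lo x..hi x}\<close>.\<close>

definition interval_order :: "'a set \<Rightarrow> 'a rel \<Rightarrow> bool" where
  "interval_order P r \<longleftrightarrow> finite_poset P r \<and>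
     (\<exists>(lo :: 'a \<Rightarrow> real) hi. (\<forall>x\<in>P. lo x \<le> hi x) \<and>
        (\<forall>x\<in>P. \<forall>y\<in>P. (x, y) \<in> r - Id \<longleftrightarrow> hi x < lo y))"

definition bounded_interval_order :: "'a set \<Rightarrow> 'a rel \<Rightarrow> bool" where
  "bounded_interval_order P r \<longleftrightarrow> bounded_poset P r \<and> interval_order P r"

definition covers :: "'a set \<Rightarrow> 'a rel \<Rightarrow> 'a \<Rightarrow> 'a \<Rightarrow> bool" where
  "covers P r x y \<longleftrightarrow> x \<in> P \<and> y \<in> P \<and> (x, y) \<in> r - Id \<and>
     \<not> (\<exists>z\<in>P. (x, z) \<in> r - Id \<and> (z, y) \<in> r - Id)"

text \<open>\<open>interval_chain P r x y c\<close>: the list \<open>c\<close> is a maximal chain of the interval \<open>[x, y]\<close>, listed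
  from bottom to top, including both end points.\<close>

definition interval_chain :: "'a set \<Rightarrow> 'a rel \<Rightarrow> 'a \<Rightarrow> 'a \<Rightarrow> 'a list \<Rightarrow> bool" where
  "interval_chain P r x y c \<longleftrightarrow> c \<noteq> [] \<and> hd c = x \<and> last c = y \<and> set c \<subseteq> P \<and>
     successively (covers P r) c"

definition maximal_chain :: "'a set \<Rightarrow> 'a rel \<Rightarrow> 'a list \<Rightarrow> bool" where
  "maximal_chain P r m \<longleftrightarrow> interval_chain P r (poset_bot P r) (poset_top P r) m"

definition edges :: "'a list \<Rightarrow> ('a \<times> 'a) list" where
  "edges c = zip c (tl c)"

text \<open>The values of a labeling \<open>lab m e\<close> only matter when \<open>m\<close> is a maximal chain and \<open>e\<close> is
  an edge of \<open>m\<close>.\<close>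

definition chain_edge_labeling ::
  "'a set \<Rightarrow> 'a rel \<Rightarrow> 'l set \<Rightarrow> ('a list \<Rightarrow> 'a \<times> 'a \<Rightarrow> 'l) \<Rightarrow> bool" where
  "chain_edge_labeling P r L lab \<longleftrightarrow>
     (\<forall>m. maximal_chain P r m \<longrightarrow> (\<forall>e\<in>set (edges m). lab m e \<in> L)) \<and>
     (\<forall>m m' d. maximal_chain P r m \<longrightarrow> maximal_chain P r m' \<longrightarrow>
        take d (edges m) = take d (edges m') \<longrightarrow>
        (\<forall>e\<in>set (take d (edges m)). lab m e = lab m' e))"

text \<open>Label sequence of a maximal chain \<open>c\<close> of the rooted interval \<open>[x, y]\<close> with root \<open>q\<close>, where
  \<open>q\<close> ends at the first element of \<open>c\<close>. By the lemmas \<open>maximal_chain_extension\<close> and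
  \<open>rooted_labels_eq\<close> below, the choice of the maximal chain exists and is irrelevant.\<close>

definition rooted_labels ::
  "'a set \<Rightarrow> 'a rel \<Rightarrow> ('a list \<Rightarrow> 'a \<times> 'a \<Rightarrow> 'l) \<Rightarrow> 'a list \<Rightarrow> 'a list \<Rightarrow> 'l list" where
  "rooted_labels P r lab q c =
     map (lab (SOME m. maximal_chain P r m \<and> prefix (q @ tl c) m)) (edges c)"

definition increasing :: "'l rel \<Rightarrow> 'l list \<Rightarrow> bool" where
  "increasing \<Lambda> ls \<longleftrightarrow> successively (\<lambda>a b. (a, b) \<in> \<Lambda> - Id) ls"

text \<open>\<open>lexord (\<Lambda> - Id)\<close> is exactly lexicographic precedence: strictly smaller at the first
  difference, or a proper initial segment.\<close>

definition CL_labeling ::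
  "'a set \<Rightarrow> 'a rel \<Rightarrow> 'l set \<Rightarrow> 'l rel \<Rightarrow> ('a list \<Rightarrow> 'a \<times> 'a \<Rightarrow> 'l) \<Rightarrow> bool" where
  "CL_labeling P r L \<Lambda> lab \<longleftrightarrow>
     partial_order_on L \<Lambda> \<and> chain_edge_labeling P r L lab \<and>
     (\<forall>x\<in>P. \<forall>y\<in>P. \<forall>q. (x, y) \<in> r - Id \<longrightarrow> interval_chain P r (poset_bot P r) x q \<longrightarrow>
        (\<exists>!c. interval_chain P r x y c \<and> increasing \<Lambda> (rooted_labels P r lab q c)) \<and>
        (\<forall>c c'. interval_chain P r x y c \<longrightarrow> increasing \<Lambda> (rooted_labels P r lab q c) \<longrightarrow>
           interval_chain P r x y c' \<longrightarrow> c' \<noteq> c \<longrightarrow>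
           (rooted_labels P r lab q c, rooted_labels P r lab q c') \<in> lexord (\<Lambda> - Id)))"

text \<open>The label poset may be taken to live on natural numbers, because only finitely many labels
  are used; lemma \<open>CL_labeling_imp_CL_shellable\<close> below shows that no label poset of any other
  type gives more.\<close>

definition CL_shellable :: "'a set \<Rightarrow> 'a rel \<Rightarrow> bool" where
  "CL_shellable P r \<longleftrightarrow> (\<exists>(L :: nat set) \<Lambda> lab. CL_labeling P r L \<Lambda> lab)"


lemma poset_bot_eq: "partial_order_on P r \<Longrightarrow> is_least P r b \<Longrightarrow> poset_bot P r = b"
  unfolding poset_bot_def is_least_def partial_order_on_def
  by (rule the_equality) (auto dest: antisymD)

lemma poset_top_eq: "partial_order_on P r \<Longrightarrow> is_greatest P r t \<Longrightarrow> poset_top P r = t"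
  unfolding poset_top_def is_greatest_def partial_order_on_def
  by (rule the_equality) (auto dest: antisymD)

lemma strict_trans:
  assumes "partial_order_on P r" "(x, y) \<in> r - Id" "(y, z) \<in> r"
  shows "(x, z) \<in> r - Id"
  using assms unfolding partial_order_on_def preorder_on_def
  by (auto dest: transD antisymD)

lemma strict_trans':
  assumes "partial_order_on P r" "(x, y) \<in> r" "(y, z) \<in> r - Id"
  shows "(x, z) \<in> r - Id"
  using assms unfolding partial_order_on_def preorder_on_def
  by (auto dest: transD antisymD)

lemma interval_chain_exists:
  assumes "finite_poset P r" "x \<in> P" "y \<in> P" "(x, y) \<in> r"
  shows "\<exists>c. interval_chain P r x y c"
  using assms(2-4)
proof (induction "card {z\<in>P. (x, z) \<in> r \<and> (z, y) \<in> r}" arbitrary: x rule: less_induct)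
  case less
  have fin: "finite P" and po: "partial_order_on P r"
    using assms(1) by (auto simp: finite_poset_def)
  have refl: "(z, z) \<in> r" if "z \<in> P" for z
    using po that by (auto simp: partial_order_on_def preorder_on_def refl_on_def)
  show ?case
  proof (cases "x = y")
    case True
    then show ?thesis using less.prems by (intro exI[of _ "[x]"]) (simp add: interval_chain_def)
  next
    case False
    define S where "S = {z\<in>P. (x, z) \<in> r - Id \<and> (z, y) \<in> r}"
    have "finite S" "y \<in> S" using fin False less.prems refl by (auto simp: S_def)
    have "\<exists>z\<in>S. \<forall>w\<in>S. (w, z) \<notin> r - Id"
    proof -
      have "acyclic (r - Id)"
      proof -
        have "trans (r - Id)"
        proof (rule transI)
          fix u v w assume "(u, v) \<in> r - Id" "(v, w) \<in> r - Id"
          then show "(u, w) \<in> r - Id" using strict_trans[OF po, of u v w] by blast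
        qed
        then show ?thesis by (simp add: acyclic_irrefl irrefl_def)
      qed
      moreover have "finite r"
        using partial_order_onD(4)[OF po] fin finite_subset[of r "P \<times> P"] by simp
      ultimately have "wf (r - Id)" by (simp add: finite_acyclic_wf)
      then show ?thesis using \<open>y \<in> S\<close> by (metis wf_eq_minimal)
    qed
    then obtain z where z: "z \<in> S" "\<forall>w\<in>S. (w, z) \<notin> r - Id" by blast
    have cov: "covers P r x z"
      unfolding covers_def
    proof (intro conjI notI)
      assume "\<exists>w\<in>P. (x, w) \<in> r - Id \<and> (w, z) \<in> r - Id"
      then obtain w where w: "w \<in> P" "(x, w) \<in> r - Id" "(w, z) \<in> r - Id" by blast
      have "(z, y) \<in> r" using z(1) by (simp add: S_def)
      then have "(w, y) \<in> r" using w(3) strict_trans[OF po, of w z y] by blast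
      then have "w \<in> S" using w by (simp add: S_def)
      then show False using z(2) w(3) by blast
    qed (use z(1) less.prems in \<open>auto simp: S_def\<close>)
    have "{w\<in>P. (z, w) \<in> r \<and> (w, y) \<in> r} \<subset> {w\<in>P. (x, w) \<in> r \<and> (w, y) \<in> r}"
    proof
      show "{w\<in>P. (z, w) \<in> r \<and> (w, y) \<in> r} \<subseteq> {w\<in>P. (x, w) \<in> r \<and> (w, y) \<in> r}"
        using z(1) partial_order_onD(2)[OF po] by (auto simp: S_def dest: transD)
      have "x \<notin> {w\<in>P. (z, w) \<in> r \<and> (w, y) \<in> r}"
        using z(1) partial_order_onD(3)[OF po] by (auto simp: S_def dest: antisymD)
      moreover have "x \<in> {w\<in>P. (x, w) \<in> r \<and> (w, y) \<in> r}"
        using less.prems refl by auto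
      ultimately show "{w\<in>P. (z, w) \<in> r \<and> (w, y) \<in> r} \<noteq> {w\<in>P. (x, w) \<in> r \<and> (w, y) \<in> r}"
        by blast
    qed
    then have "card {w\<in>P. (z, w) \<in> r \<and> (w, y) \<in> r} < card {w\<in>P. (x, w) \<in> r \<and> (w, y) \<in> r}"
      using fin by (intro psubset_card_mono) auto
    then obtain c where "interval_chain P r z y c"
      using less.hyps[of z] z(1) less.prems by (auto simp: S_def)
    then have "interval_chain P r x y (x # c)"
      using cov less.prems by (auto simp: interval_chain_def successively_Cons)
    then show ?thesis by blast
  qed
qed

lemma interval_chain_append:
  assumes "interval_chain P r x y c" "interval_chain P r y z d"
  shows "interval_chain P r x z (c @ tl d)"
proof -
  obtain d' where d: "d = y # d'" using assms(2) by (cases d) (auto simp: interval_chain_def)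
  show ?thesis
    using assms unfolding d interval_chain_def
    by (auto simp: successively_append_iff successively_Cons)
qed

lemma interval_chain_mem: "interval_chain P r x y c \<Longrightarrow> x \<in> P \<and> y \<in> P"
  unfolding interval_chain_def by auto

lemma maximal_chain_extension:
  assumes "bounded_poset P r" "interval_chain P r (poset_bot P r) x q" "interval_chain P r x y c"
  shows "\<exists>m. maximal_chain P r m \<and> prefix (q @ tl c) m"
proof -
  have fp: "finite_poset P r" and po: "partial_order_on P r"
    using assms(1) by (auto simp: bounded_poset_def finite_poset_def)
  obtain t where t: "is_greatest P r t" using assms(1) by (auto simp: bounded_poset_def)
  have "y \<in> P" using interval_chain_mem[OF assms(3)] by simp
  then obtain s where "interval_chain P r y t s"
    using interval_chain_exists[OF fp, of y t] t by (auto simp: is_greatest_def)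
  then have "maximal_chain P r ((q @ tl c) @ tl s)"
    using interval_chain_append[OF interval_chain_append[OF assms(2,3)]] poset_top_eq[OF po t]
    by (auto simp: maximal_chain_def)
  then show ?thesis by (auto simp: prefix_def)
qed

lemma edges_append:
  assumes "q \<noteq> []" "c \<noteq> []" "last q = hd c"
  shows "edges (q @ tl c @ s) = edges q @ edges c @ edges (last c # s)"
  using assms
proof (induction q rule: list_nonempty_induct)
  case (single x)
  then have "c \<noteq> []" "x = hd c" by auto
  then show ?case
  proof (induction c arbitrary: x rule: list_nonempty_induct)
    case (single y) then show ?case by (simp add: edges_def)
  next
    case (cons y ys)
    then show ?case by (cases ys) (auto simp: edges_def)
  qed
next
  case (cons x xs)
  then show ?case by (cases xs) (auto simp: edges_def)
qed

lemma edges_prefix: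
  assumes "interval_chain P r b x q" "interval_chain P r x y c" "prefix (q @ tl c) m"
  shows "\<exists>es. edges m = (edges q @ edges c) @ es"
proof -
  obtain s where "m = q @ tl c @ s" using assms(3) by (auto simp: prefix_def)
  then show ?thesis
    using edges_append[of q c s] assms(1,2) by (auto simp: interval_chain_def)
qed

lemma rooted_labels_eq:
  assumes "chain_edge_labeling P r L lab"
    and "interval_chain P r (poset_bot P r) x q" "interval_chain P r x y c"
    and "maximal_chain P r m" "prefix (q @ tl c) m"
  shows "rooted_labels P r lab q c = map (lab m) (edges c)"
proof -
  define m' where "m' = (SOME m. maximal_chain P r m \<and> prefix (q @ tl c) m)"
  have m': "maximal_chain P r m'" "prefix (q @ tl c) m'"
    using someI[of "\<lambda>m. maximal_chain P r m \<and> prefix (q @ tl c) m" m] assms(4,5)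
    by (auto simp: m'_def)
  obtain es es' where es: "edges m = (edges q @ edges c) @ es" "edges m' = (edges q @ edges c) @ es'"
    using edges_prefix[OF assms(2,3,5)] edges_prefix[OF assms(2,3) m'(2)] by blast
  let ?d = "length (edges q @ edges c)"
  have t: "take ?d (edges m') = edges q @ edges c" "take ?d (edges m) = edges q @ edges c"
    using es by simp_all
  have eq: "take ?d (edges m') = take ?d (edges m)" using t by simp
  have "\<forall>e\<in>set (take ?d (edges m')). lab m' e = lab m e"
    using assms(1)[unfolded chain_edge_labeling_def, THEN conjunct2, rule_format,
        OF m'(1) assms(4) eq] by blast
  then show ?thesis unfolding rooted_labels_def m'_def[symmetric] t by simp
qed

lemma interval_chain_distinct:
  assumes "finite_poset P r" "interval_chain P r x y c"
  shows "distinct c"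
proof -
  have po: "partial_order_on P r" using assms(1) by (simp add: finite_poset_def)
  have "successively (\<lambda>a b. (a, b) \<in> r - Id) c"
    using assms(2) unfolding interval_chain_def
    by (auto elim: successively_mono simp: covers_def)
  then have "sorted_wrt (\<lambda>a b. (a, b) \<in> r - Id) c"
  proof (subst successively_conv_sorted_wrt[symmetric])
    show "transp (\<lambda>a b. (a, b) \<in> r - Id)"
    proof (rule transpI)
      fix u v w assume "(u, v) \<in> r - Id" "(v, w) \<in> r - Id"
      then show "(u, w) \<in> r - Id" using strict_trans[OF po, of u v w] by blast
    qed
  qed
  then show ?thesis by (induction c) auto
qed

lemma lexord_map:
  assumes "(xs, ys) \<in> lexord R" "set xs \<subseteq> S" "set ys \<subseteq> S"
    and "\<And>a b. a \<in> S \<Longrightarrow> b \<in> S \<Longrightarrow> (a, b) \<in> R \<Longrightarrow> (f a, f b) \<in> R'"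
  shows "(map f xs, map f ys) \<in> lexord R'"
proof -
  consider a v where "ys = xs @ a # v"
    | u a b v w where "(a, b) \<in> R" "xs = u @ a # v" "ys = u @ b # w"
    using assms(1) unfolding lexord_def by blast
  then show ?thesis
  proof cases
    case 1 then show ?thesis unfolding lexord_def by auto
  next
    case 2
    then have "(f a, f b) \<in> R'" using assms(2-4) by auto
    then show ?thesis unfolding lexord_def using 2 by fastforce
  qed
qed

lemma successively_cong_set:
  assumes "set xs \<subseteq> S" "\<And>a b. a \<in> S \<Longrightarrow> b \<in> S \<Longrightarrow> Q a b \<longleftrightarrow> Q' a b"
  shows "successively Q xs \<longleftrightarrow> successively Q' xs"
  using assms(1)
proof (induction xs)
  case (Cons a xs)
  then show ?case using assms(2)[of a "hd xs"] by (cases xs) (auto simp: successively_Cons)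
qed simp

lemma CL_labeling_imp_CL_shellable:
  fixes L :: "'l set"
  assumes bp: "bounded_poset P r" and CL: "CL_labeling P r L \<Lambda> lab"
  shows "CL_shellable P r"
proof -
  have fp: "finite_poset P r" and finP: "finite P"
    using bp by (auto simp: bounded_poset_def finite_poset_def)
  have po: "partial_order_on L \<Lambda>" and cel: "chain_edge_labeling P r L lab"
    using CL by (auto simp: CL_labeling_def)
  define S where "S = (\<Union>m\<in>{m. maximal_chain P r m}. lab m ` set (edges m))"
  have "{m. maximal_chain P r m} \<subseteq> {m. set m \<subseteq> P \<and> distinct m}"
    using interval_chain_distinct[OF fp] by (auto simp: maximal_chain_def) (auto simp: interval_chain_def)
  then have "finite {m. maximal_chain P r m}"
    using finP finite_subset_distinct[OF finP] by (simp add: finite_subset)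
  then have "finite S" by (auto simp: S_def)
  then obtain f :: "'l \<Rightarrow> nat" where inj: "inj_on f S"
    using finite_imp_inj_to_nat_seg by blast
  have SL: "S \<subseteq> L" using cel by (auto simp: S_def chain_edge_labeling_def)
  define \<Lambda>' where "\<Lambda>' = (\<lambda>(a, b). (f a, f b)) ` (\<Lambda> \<inter> S \<times> S)"
  have iff: "(f a, f b) \<in> \<Lambda>' \<longleftrightarrow> (a, b) \<in> \<Lambda>" if "a \<in> S" "b \<in> S" for a b
    using that inj by (auto simp: \<Lambda>'_def inj_on_def)
  have iff': "(f a, f b) \<in> \<Lambda>' - Id \<longleftrightarrow> (a, b) \<in> \<Lambda> - Id" if "a \<in> S" "b \<in> S" for a b
    using iff[OF that] that inj by (auto simp: inj_on_def)
  have sub: "\<Lambda>' \<subseteq> f ` S \<times> f ` S" by (auto simp: \<Lambda>'_def)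
  have po': "partial_order_on (f ` S) \<Lambda>'"
    unfolding partial_order_on_def preorder_on_def
  proof (intro conjI sub)
    show "refl_on (f ` S) \<Lambda>'"
      using partial_order_onD(1)[OF po] SL iff by (auto simp: refl_on_def)
    show "trans \<Lambda>'"
    proof (rule transI)
      fix u v w assume uv: "(u, v) \<in> \<Lambda>'" and vw: "(v, w) \<in> \<Lambda>'"
      then obtain a b c where "a \<in> S" "b \<in> S" "c \<in> S" "u = f a" "v = f b" "w = f c"
        using sub by blast
      then show "(u, w) \<in> \<Lambda>'"
        using uv vw iff transD[OF partial_order_onD(2)[OF po], of a b c] by simp
    qed
    show "antisym \<Lambda>'"
    proof (rule antisymI)
      fix u v assume uv: "(u, v) \<in> \<Lambda>'" and vu: "(v, u) \<in> \<Lambda>'"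
      then obtain a b where "a \<in> S" "b \<in> S" "u = f a" "v = f b"
        using sub by blast
      then show "u = v"
        using uv vu iff antisymD[OF partial_order_onD(3)[OF po], of a b] by simp
    qed
  qed
  define lab' where "lab' = (\<lambda>m e. f (lab m e))"
  have cel': "chain_edge_labeling P r (f ` S) lab'"
    unfolding chain_edge_labeling_def
  proof (intro conjI allI impI ballI)
    fix m e assume "maximal_chain P r m" "e \<in> set (edges m)"
    then show "lab' m e \<in> f ` S" by (auto simp: lab'_def S_def)
  next
    fix m m' d e
    assume "maximal_chain P r m" "maximal_chain P r m'"
      "take d (edges m) = take d (edges m')" "e \<in> set (take d (edges m))"
    then show "lab' m e = lab' m' e"
      using cel[unfolded chain_edge_labeling_def, THEN conjunct2, rule_format, of m m' d e]
      by (simp add: lab'_def)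
  qed
  have rl: "rooted_labels P r lab' q c = map f (rooted_labels P r lab q c)" for q c
    by (simp add: rooted_labels_def lab'_def)
  have inS: "set (rooted_labels P r lab q c) \<subseteq> S"
    if qc: "interval_chain P r (poset_bot P r) x q" "interval_chain P r x y c" for q c x y
  proof -
    obtain m where m: "maximal_chain P r m" "prefix (q @ tl c) m"
      using maximal_chain_extension[OF bp qc] by blast
    then have "set (edges c) \<subseteq> set (edges m)" using edges_prefix[OF qc m(2)] by auto
    then show ?thesis using rooted_labels_eq[OF cel qc m] m(1) by (auto simp: S_def)
  qed
  have incr: "increasing \<Lambda>' (rooted_labels P r lab' q c) \<longleftrightarrow> increasing \<Lambda> (rooted_labels P r lab q c)"
    if qc: "interval_chain P r (poset_bot P r) x q" "interval_chain P r x y c" for q c x y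
    unfolding increasing_def rl successively_map
    by (rule successively_cong_set[OF inS[OF qc] iff'])
  have "CL_labeling P r (f ` S) \<Lambda>' lab'"
    unfolding CL_labeling_def
  proof (intro conjI po' cel' ballI allI impI)
    fix x y q
    assume xy: "x \<in> P" "y \<in> P" "(x, y) \<in> r - Id" and q: "interval_chain P r (poset_bot P r) x q"
    have u: "\<exists>!c. interval_chain P r x y c \<and> increasing \<Lambda> (rooted_labels P r lab q c)"
      using CL xy q unfolding CL_labeling_def by blast
    have "(interval_chain P r x y c \<and> increasing \<Lambda>' (rooted_labels P r lab' q c)) =
      (interval_chain P r x y c \<and> increasing \<Lambda> (rooted_labels P r lab q c))" for c
      using incr[OF q, of y c] by blast
    then show "\<exists>!c. interval_chain P r x y c \<and> increasing \<Lambda>' (rooted_labels P r lab' q c)"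
      using u by simp
  next
    fix x y q c c'
    assume xy: "x \<in> P" "y \<in> P" "(x, y) \<in> r - Id" and q: "interval_chain P r (poset_bot P r) x q"
      and c: "interval_chain P r x y c" "increasing \<Lambda>' (rooted_labels P r lab' q c)"
      and c': "interval_chain P r x y c'" "c' \<noteq> c"
    have "increasing \<Lambda> (rooted_labels P r lab q c)" using incr[OF q c(1)] c(2) by simp
    then have "(rooted_labels P r lab q c, rooted_labels P r lab q c') \<in> lexord (\<Lambda> - Id)"
      using CL xy q c(1) c' unfolding CL_labeling_def by blast
    then show "(rooted_labels P r lab' q c, rooted_labels P r lab' q c') \<in> lexord (\<Lambda>' - Id)"
      unfolding rl using inS[OF q c(1)] inS[OF q c'(1)] iff' by (intro lexord_map[where S = S]) auto
  qed
  then show ?thesis unfolding CL_shellable_def by blast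
qed

end

theory Submission
  imports Defs
begin

text \<open>Among the covers of \<open>x\<close>, let \<open>a\<close> be one whose interval ends first. Then \<open>a\<close> lies below every
  \<open>y > x\<close> that does not cover \<open>x\<close>. Label the edge \<open>(x, a)\<close> by the number of elements weakly below
  \<open>x\<close>, and all other edges by \<open>card P\<close>. Two consecutive edges \<open>(w, x)\<close>, \<open>(x, y)\<close> then carry
  increasing labels iff \<open>x\<close> is the selected cover of \<open>w\<close>; so the increasing chain of an interval is
  the greedy one, and any other chain first leaves it along an edge with the largest label. The
  labels do not depend on the maximal chain, so this is even an EL-labeling.\<close>

locale bounded_interval_representation =
  fixes P :: "'a set" and r :: "'a rel" and lo hi :: "'a \<Rightarrow> real"
  assumes bounded: "bounded_poset P r"
    and less_iff: "\<And>x y. x \<in> P \<Longrightarrow> y \<in> P \<Longrightarrow> (x, y) \<in> r - Id \<longleftrightarrow> hi x < lo y"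
begin

lemma finite_poset: "finite_poset P r"
  and finite_carrier: "finite P"
  and partial_order: "partial_order_on P r"
  using bounded by (auto simp: bounded_poset_def finite_poset_def)

text \<open>Ties in \<open>hi\<close> are broken by choice. The top element has no covers, so there
  the value is arbitrary; facts about \<open>first_cover x\<close> first need some cover of
  \<open>x\<close>.\<close>

definition first_cover :: "'a \<Rightarrow> 'a" where
  "first_cover x = arg_min_on hi {a. covers P r x a}"

lemma
  assumes "covers P r x b"
  shows covers_first_cover: "covers P r x (first_cover x)"
    and hi_first_cover_le: "hi (first_cover x) \<le> hi b"
proof -
  have "finite {a. covers P r x a}"
    using finite_carrier by (rule rev_finite_subset) (auto simp: covers_def)
  then show "covers P r x (first_cover x)" "hi (first_cover x) \<le> hi b"
    using assms arg_min_if_finite(1)[of "{a. covers P r x a}" hi] arg_min_least[of "{a. covers P r x a}" b hi]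
    by (auto simp: first_cover_def)
qed

lemma interval_chain_Cons_Cons:
  "interval_chain P r x y (u # v # c) \<longleftrightarrow> u = x \<and> covers P r x v \<and> interval_chain P r v y (v # c)"
  by (auto simp: interval_chain_def covers_def)

lemma interval_chain_le: "interval_chain P r x y c \<Longrightarrow> (x, y) \<in> r"
proof (induction c arbitrary: x)
  case Nil
  then show ?case by (simp add: interval_chain_def)
next
  case (Cons u c)
  show ?case
  proof (cases c)
    case Nil
    then show ?thesis using Cons.prems partial_order_onD(1)[OF partial_order]
      by (auto simp: interval_chain_def refl_on_def)
  next
    case (Cons v c')
    then have v: "covers P r x v" "interval_chain P r v y c"
      using Cons.prems by (simp_all add: interval_chain_Cons_Cons)
    then show ?thesis using Cons.IH[OF v(2)] strict_trans[OF partial_order, of x v y]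
      by (auto simp: covers_def)
  qed
qed

lemma interval_chain_refl: "interval_chain P r x x c \<longleftrightarrow> x \<in> P \<and> c = [x]"
proof
  assume c: "interval_chain P r x x c"
  then have "distinct c" by (rule interval_chain_distinct[OF finite_poset])
  with c show "x \<in> P \<and> c = [x]"
    by (cases c) (auto simp: interval_chain_def split: if_splits)
qed (simp add: interval_chain_def)

lemma interval_chain_stepE:
  assumes "interval_chain P r x y c" "x \<noteq> y"
  obtains a c' where "c = x # a # c'" "covers P r x a" "interval_chain P r a y (a # c')"
proof (cases c rule: remdups_adj.cases)
  case (3 u a c')
  then show ?thesis using assms that by (auto simp: interval_chain_Cons_Cons)
qed (use assms in \<open>auto simp: interval_chain_def\<close>)

text \<open>A maximal chain from \<open>x\<close> to \<open>y\<close> starts with a cover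
  \<open>a\<close> of \<open>x\<close>, and \<open>a\<close> differs from \<open>y\<close>, so
  \<open>hi a < lo y\<close>. The selected cover ends no later than \<open>a\<close>, hence also
  before \<open>y\<close> begins. Only here is the order compared with the intervals.\<close>

lemma first_cover_less:
  assumes "x \<in> P" "y \<in> P" "(x, y) \<in> r - Id" "\<not> covers P r x y"
  shows "covers P r x (first_cover x)" "(first_cover x, y) \<in> r - Id"
proof -
  obtain c where c: "interval_chain P r x y c"
    using interval_chain_exists[OF finite_poset] assms by blast
  have "x \<noteq> y" using assms(3) by blast
  then obtain a c' where a: "covers P r x a" "interval_chain P r a y (a # c')"
    using interval_chain_stepE[OF c] by metis
  show first: "covers P r x (first_cover x)" using a(1) by (rule covers_first_cover)
  have "(a, y) \<in> r - Id" using a interval_chain_le[OF a(2)] assms(4) by auto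
  then show "(first_cover x, y) \<in> r - Id"
    using hi_first_cover_le[OF a(1)] less_iff[of a y] less_iff[of "first_cover x" y] a(1) first assms(2)
    by (auto simp: covers_def)
qed

definition edge_label :: "'a \<times> 'a \<Rightarrow> nat" where
  "edge_label = (\<lambda>(x, a). if a = first_cover x then card {z \<in> P. (z, x) \<in> r} else card P)"

definition increasing_chain :: "'a list \<Rightarrow> bool" where
  "increasing_chain c \<longleftrightarrow> successively (<) (map edge_label (edges c))"

lemma card_down_mono:
  assumes "x \<in> P" "y \<in> P" "(x, y) \<in> r - Id"
  shows "card {z \<in> P. (z, x) \<in> r} < card {z \<in> P. (z, y) \<in> r}"
proof (rule psubset_card_mono)
  have "(y, y) \<in> r" "(y, x) \<notin> r"
    using assms partial_order_onD[OF partial_order] by (auto simp: refl_on_def dest: antisymD)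
  moreover have "(z, y) \<in> r" if "(z, x) \<in> r" for z
    using strict_trans'[OF partial_order that assms(3)] by blast
  ultimately show "{z \<in> P. (z, x) \<in> r} \<subset> {z \<in> P. (z, y) \<in> r}" using assms(2) by blast
qed (use finite_carrier in simp)

lemma edge_label_le: "edge_label e \<le> card P"
  using finite_carrier by (auto simp: edge_label_def split: prod.split intro: card_mono)

text \<open>The cover \<open>a\<close> is not weakly below \<open>x\<close>, so the count at
  \<open>x\<close> misses an element of \<open>P\<close>.\<close>

lemma edge_label_first_less:
  assumes "covers P r x a"
  shows "edge_label (x, first_cover x) < card P"
  using card_down_mono[of x a] assms card_mono[OF finite_carrier, of "{z \<in> P. (z, a) \<in> r}"]
  by (auto simp: edge_label_def covers_def)

text \<open>For a selected \<open>a\<close>, the count at \<open>x\<close> is smaller than both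
  possible labels of the next edge. For any other \<open>a\<close>, the first label is already the
  maximum \<open>card P\<close>.\<close>

lemma edge_label_less_iff:
  assumes "covers P r x a" "covers P r a b"
  shows "edge_label (x, a) < edge_label (a, b) \<longleftrightarrow> a = first_cover x"
proof
  assume "a = first_cover x"
  then show "edge_label (x, a) < edge_label (a, b)"
    using assms card_down_mono[of x a] edge_label_first_less[OF assms(1)]
    by (auto simp: edge_label_def covers_def)
qed (use edge_label_le[of "(a, b)"] in \<open>auto simp: edge_label_def split: if_splits\<close>)

text \<open>The last edge has no successor to be compared with, so it may lead to a cover that is
  not the selected one; hence the proviso \<open>c \<noteq> []\<close>.\<close>

lemma increasing_chain_Cons:
  assumes "interval_chain P r x y (x # a # c)"
  shows "increasing_chain (x # a # c) \<longleftrightarrow> (c \<noteq> [] \<longrightarrow> a = first_cover x) \<and> increasing_chain (a # c)"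
  using assms
  by (cases c) (auto simp: increasing_chain_def edges_def interval_chain_Cons_Cons edge_label_less_iff)

text \<open>Greedy construction: finish with a single edge once \<open>y\<close> covers
  \<open>x\<close>; otherwise step to the selected cover, which stays below
  \<open>y\<close>.\<close>

lemma increasing_chain_exists:
  assumes "x \<in> P" "y \<in> P" "(x, y) \<in> r - Id"
  shows "\<exists>c. interval_chain P r x y c \<and> increasing_chain c"
  using assms
proof (induction "card P - card {z \<in> P. (z, x) \<in> r}" arbitrary: x rule: less_induct)
  case less
  show ?case
  proof (cases "covers P r x y")
    case True
    then have "interval_chain P r x y [x, y]" "increasing_chain [x, y]"
      by (auto simp: interval_chain_def covers_def increasing_chain_def edges_def)
    then show ?thesis by blast
  next
    case False
    let ?a = "first_cover x"
    have a: "covers P r x ?a" "(?a, y) \<in> r - Id"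
      using first_cover_less[OF less.prems False] .
    \<comment> \<open>Truncated subtraction decreases strictly only because the count at
      \<open>x\<close> is below \<open>card P\<close>, which is what
      \<open>edge_label_first_less\<close> supplies.\<close>
    have "card P - card {z \<in> P. (z, ?a) \<in> r} < card P - card {z \<in> P. (z, x) \<in> r}"
      using card_down_mono[of x ?a] edge_label_first_less[OF a(1)] a(1)
      by (auto simp: covers_def edge_label_def)
    then obtain c where c: "interval_chain P r ?a y c" "increasing_chain c"
      using less.hyps[of ?a] a less.prems(2) by (auto simp: covers_def)
    obtain c' where c': "c = ?a # c'" using c(1) by (cases c) (auto simp: interval_chain_def)
    have "interval_chain P r x y (x # c)"
      using a(1) c(1) c' by (simp add: interval_chain_Cons_Cons)
    then show ?thesis using increasing_chain_Cons[of x y ?a c'] c(2) c' by auto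
  qed
qed

text \<open>A common first edge carries equal labels and is stripped off. Where the chains part, the
  increasing one takes the selected cover, so the other gets the label
  \<open>card P\<close>.\<close>

lemma increasing_chain_lex_first:
  assumes "interval_chain P r x y c" "increasing_chain c" "interval_chain P r x y c'" "c' \<noteq> c"
  shows "(map edge_label (edges c), map edge_label (edges c')) \<in> lexord {(a, b). a < b}"
  using assms
proof (induction c arbitrary: x c')
  case Nil
  then show ?case by (simp add: interval_chain_def)
next
  case (Cons u d)
  have "x \<noteq> y" using Cons.prems interval_chain_refl by metis
  then obtain a c where c: "u = x" "d = a # c" "covers P r x a" "interval_chain P r a y (a # c)"
    using interval_chain_stepE[OF Cons.prems(1)] by blast
  obtain b e where e: "c' = x # b # e" "covers P r x b" "interval_chain P r b y (b # e)"
    using interval_chain_stepE[OF Cons.prems(3) \<open>x \<noteq> y\<close>] .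
  have inc: "c \<noteq> [] \<longrightarrow> a = first_cover x" "increasing_chain (a # c)"
    using increasing_chain_Cons[of x y a c] Cons.prems(1,2) c by auto
  show ?case
  proof (cases "a = b")
    case True
    then have "(map edge_label (edges d), map edge_label (edges (b # e))) \<in> lexord {(a, b). a < b}"
      using Cons.IH[of a "b # e"] c e inc Cons.prems(4) by simp
    then show ?thesis using True c e by (simp add: edges_def)
  next
    case False
    \<comment> \<open>If the increasing chain ended at \<open>a = y\<close>, then \<open>b\<close>
      would lie strictly between \<open>x\<close> and its cover \<open>a\<close>.\<close>
    have "c \<noteq> []"
    proof
      assume "c = []"
      then have "a = y" using c(4) by (simp add: interval_chain_def)
      then have "(b, a) \<in> r - Id" using interval_chain_le[OF e(3)] False by auto
      then show False using c(3) e(2) unfolding covers_def by blast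
    qed
    then have "edge_label (x, a) < edge_label (x, b)"
      using inc(1) False edge_label_first_less[OF c(3)] by (auto simp: edge_label_def)
    then show ?thesis using c e by (simp add: edges_def)
  qed
qed

text \<open>The labels ignore the maximal chain, so agreement on common initial edges is immediate
  and the choice inside \<open>rooted_labels\<close> disappears.\<close>

lemma CL_labeling_edge_label:
  "CL_labeling P r UNIV {(a, b). a \<le> b} (\<lambda>m. edge_label)"
proof -
  have strict: "{(a, b). a \<le> b} - Id = {(a, b :: nat). a < b}" by auto
  have labels: "rooted_labels P r (\<lambda>m. edge_label) q c = map edge_label (edges c)" for q c
    by (simp add: rooted_labels_def)
  have inc: "increasing {(a, b). a \<le> b} (map edge_label (edges c)) \<longleftrightarrow> increasing_chain c" for c
    by (simp add: increasing_def strict increasing_chain_def)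
  \<comment> \<open>Two distinct increasing chains would each precede the other
    lexicographically.\<close>
  have unique: "c = c'"
    if "interval_chain P r x y c" "increasing_chain c" "interval_chain P r x y c'" "increasing_chain c'"
    for x y c c'
  proof (rule ccontr)
    let ?w = "\<lambda>c. map edge_label (edges c)"
    assume "c \<noteq> c'"
    then have "(?w c, ?w c') \<in> lexord {(a, b). a < b}" "(?w c', ?w c) \<in> lexord {(a, b). a < b}"
      using that increasing_chain_lex_first by metis+
    moreover have "asym (lexord {(a, b :: nat). a < b})"
      by (intro lexord_asym asymI) auto
    ultimately show False by (meson asymD)
  qed
  have "partial_order_on UNIV {(a, b :: nat). a \<le> b}"
    by (auto simp: partial_order_on_def preorder_on_def refl_on_def intro: transI antisymI)
  then show ?thesis
    unfolding CL_labeling_def labels inc unfolding strict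
    using increasing_chain_exists increasing_chain_lex_first unique
    by (auto simp: chain_edge_labeling_def simp del: Diff_iff)
qed

end

theorem theorem11:
  fixes P :: "'a set" and r :: "'a rel"
  assumes "bounded_interval_order P r"
  shows "CL_shellable P r"
proof -
  obtain lo hi :: "'a \<Rightarrow> real" where "bounded_interval_representation P r lo hi"
    using assms
    unfolding bounded_interval_order_def interval_order_def bounded_interval_representation_def
    by blast
  then interpret bounded_interval_representation P r lo hi .
  show ?thesis using CL_labeling_edge_label unfolding CL_shellable_def by blast
qed

end
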